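(* For every $f\in\mathcal E$, the sequence $(T^nf)_{n\in\mathbb N}$ converges uniformly on $[0,1]$ to $h$.
   Context: "Decreasing" means non-increasing; $\int f:=\int_0^1 f(x)\,dx$. Let $\mathcal M$ be the set of measurable $f\colon[0,1]\to[0,\infty)$ with $\int f>0$, and $\mathcal E$ the set of decreasing $f\in\mathcal M$ with $f(0)=1$. For $g\in\mathcal E$ its pseudo-inverse is $g^*(y):=\sup\{x\in[0,1]: g(x)\ge y\}$ for $y\in[0,1]$; then $g^*\in\mathcal E$ and $\int g^*=\int g$. For $g\in\mathcal M$ put $(Ig)(x):=\int_x^1 g/\int g$. Define the operator $T$ on $\mathcal E$ by $Tf:=I(f^* )$, i.e. $(Tf)(x)=\frac{\int_x^1 f^*}{\int f}$ for $x\in[0,1]$, with iterates $T^0=\mathrm{id}$, $T^n=T\circ T^{n-1}$. Let $h_0\equiv 1$ on $[0,1]$ and $h_n:=T^nh_0$. The sequence $(h_n)$ converges uniformly on $[0,1]$; let $h$ denote its limit (a continuous, strictly decreasing function with $h(0)=1$, $h(1)=0$, satisfying $Th=h$). *)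

theory Defs
  imports "HOL-Analysis.Analysis"
begin

text \<open>Functions on [0,1] are represented as real => real; only values on {0..1} matter.
  The integral is the integral over [0,1].\<close>

definition intI :: "(real \<Rightarrow> real) \<Rightarrow> real" where
  "intI f = integral {0..1} f"

definition classE :: "(real \<Rightarrow> real) set" where
  "classE = {f. f \<in> borel_measurable (lebesgue_on {0..1})
              \<and> (\<forall>x\<in>{0..1}. 0 \<le> f x)
              \<and> intI f > 0
              \<and> (\<forall>x\<in>{0..1}. \<forall>y\<in>{0..1}. x \<le> y \<longrightarrow> f y \<le> f x)
              \<and> f 0 = 1}"

definition pinv :: "(real \<Rightarrow> real) \<Rightarrow> real \<Rightarrow> real" where
  "pinv g y = Sup {x \<in> {0..1}. g x \<ge> y}"

definition Iop :: "(real \<Rightarrow> real) \<Rightarrow> real \<Rightarrow> real" where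
  "Iop g x = integral {x..1} g / intI g"

definition Top :: "(real \<Rightarrow> real) \<Rightarrow> real \<Rightarrow> real" where
  "Top f = Iop (pinv f)"

definition hseq :: "nat \<Rightarrow> real \<Rightarrow> real" where
  "hseq n = (Top ^^ n) (\<lambda>_. 1)"

definition hlim :: "real \<Rightarrow> real" where
  "hlim x = lim (\<lambda>n. hseq n x)"

end

theory Submission
  imports Defs
begin

text \<open>
  Extend functions on [0,1] by 0 and compare f with all rescalings b g(x/a) of g. Passing to the
  pseudo-inverse preserves the pattern of sign changes (with a and b exchanged), and integrating from
  the right does not create new ones. The box h_0 = 1 and any rescaled decreasing function never show
  the pattern +, -, +, so neither do h_n and the rescalings of f_n = T^n f. Because h_n and f_n agree
  at 0, this yields f_n \<le> h_n. Looking at slopes at 0, it also gives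
  h_(n+2) \<le> (c_(n+1) / c_n) f_(n+2), where c_n \<le> 1 is the ratio of the integrals of the
  pseudo-inverses of f_n and h_n. Evaluating at 0 shows that c_n increases, so c_(n+1) / c_n tends
  to 1 and f_n - h_n tends to 0 uniformly. For f = h_1 the comparison says that h_n decreases in n;
  this bounds the integrals from below, so the h_n are equi-Lipschitz and converge uniformly.
\<close>

section \<open>Decreasing functions on the unit interval and their extension by zero\<close>

definition decreasing01 :: "(real \<Rightarrow> real) \<Rightarrow> bool" where
  "decreasing01 f \<longleftrightarrow> (\<forall>x\<in>{0..1}. 0 \<le> f x) \<and> (\<forall>x\<in>{0..1}. \<forall>y\<in>{0..1}. x \<le> y \<longrightarrow> f y \<le> f x)"

text \<open>Working form of \<open>classE\<close>: for a decreasing function, a positive integral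
  amounts to a positive value at some positive point, and measurability follows from
  monotonicity.\<close>

definition profile :: "(real \<Rightarrow> real) \<Rightarrow> bool" where
  "profile f \<longleftrightarrow> decreasing01 f \<and> f 0 = 1 \<and> (\<exists>x\<in>{0<..1}. 0 < f x)"

text \<open>In \<open>g (x / a)\<close> the argument may leave the unit interval; extension by zero
  keeps a nonnegative decreasing function decreasing on the whole half-line.\<close>

definition zext :: "(real \<Rightarrow> real) \<Rightarrow> real \<Rightarrow> real" where
  "zext f x = (if 0 \<le> x \<and> x \<le> 1 then f x else 0)"

lemma profile_decreasing01: "profile f \<Longrightarrow> decreasing01 f"
  by (simp add: profile_def)

lemma profile_le_1:
  assumes "profile f" "0 \<le> x" "x \<le> 1"
  shows "f x \<le> 1"
proof -
  have "f x \<le> f 0"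
    using assms unfolding profile_def decreasing01_def by (meson atLeastAtMost_iff order_refl zero_le_one)
  with assms show ?thesis by (simp add: profile_def)
qed

lemma zext_nonneg: "decreasing01 f \<Longrightarrow> 0 \<le> zext f x"
  by (auto simp: zext_def decreasing01_def)

lemma zext_antimono: "decreasing01 f \<Longrightarrow> 0 \<le> x \<Longrightarrow> x \<le> y \<Longrightarrow> zext f y \<le> zext f x"
  by (auto simp: zext_def decreasing01_def)

lemma zext_le_1: "profile f \<Longrightarrow> zext f x \<le> 1"
  by (auto simp: zext_def profile_le_1)

lemma zext_integrable:
  assumes "decreasing01 f" "0 \<le> a"
  shows "zext f integrable_on {a..b}"
proof -
  have "mono_on {a..b} (\<lambda>x. - zext f x)"
    using assms by (auto simp: mono_on_def intro: zext_antimono)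
  from integrable_neg[OF integrable_on_mono_on[OF this]] show ?thesis by simp
qed

lemma decreasing01_integrable:
  assumes "decreasing01 f" "0 \<le> a" "b \<le> 1"
  shows "f integrable_on {a..b}"
  using zext_integrable[OF assms(1,2), of b] assms(2,3)
  by (subst integrable_cong[where g = "zext f"]) (auto simp: zext_def)

text \<open>The point is sought in the open interval, so that points found in adjacent intervals are
  strictly ordered. Dropping the endpoints leaves the integral unchanged.\<close>

lemma integral_pos_imp_pos_point:
  fixes d :: "real \<Rightarrow> real"
  assumes "d integrable_on {a..b}" "0 < integral {a..b} d"
  obtains t where "a < t" "t < b" "0 < d t"
proof -
  have "\<exists>t. a < t \<and> t < b \<and> 0 < d t"
  proof (rule ccontr)
    assume "\<nexists>t. a < t \<and> t < b \<and> 0 < d t"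
    then have n: "0 \<le> - d t" if "t \<in> {a<..<b}" for t
      using that by (force simp: not_less)
    have "(\<lambda>t. - d t) integrable_on {a<..<b}"
      using integrable_neg[OF assms(1)] by (simp add: integrable_on_Icc_iff_Ioo)
    then have "0 \<le> integral {a<..<b} (\<lambda>t. - d t)"
      by (rule integral_nonneg) (rule n)
    with assms(2) show False by (simp add: integral_open_interval_real)
  qed
  with that show thesis by blast
qed

lemma integral_neg_imp_neg_point:
  fixes d :: "real \<Rightarrow> real"
  assumes "d integrable_on {a..b}" "integral {a..b} d < 0"
  obtains t where "a < t" "t < b" "d t < 0"
  using integral_pos_imp_pos_point[of "\<lambda>t. - d t" a b] assms by (auto simp: integrable_neg)

subsection \<open>Pseudo-inverses\<close>

lemma
  assumes "profile f" "0 \<le> y" "y \<le> 1"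
  shows pinv_nonneg: "0 \<le> pinv f y" and pinv_le_1: "pinv f y \<le> 1"
proof -
  have 0: "0 \<in> {x \<in> {0..1}. y \<le> f x}" using assms by (auto simp: profile_def)
  show "0 \<le> pinv f y" unfolding pinv_def
    by (rule cSup_upper[OF 0]) (auto intro: bdd_aboveI[where M=1])
  show "pinv f y \<le> 1" unfolding pinv_def
    by (rule cSup_least) (use 0 in blast, simp)
qed

lemma pinv_decreasing01:
  assumes "profile f"
  shows "decreasing01 (pinv f)"
proof -
  have "pinv f y \<le> pinv f x" if "0 \<le> x" "x \<le> y" "y \<le> 1" for x y
    unfolding pinv_def
  proof (rule cSup_subset_mono)
    show "{u \<in> {0..1}. y \<le> f u} \<noteq> {}"
      using that assms by (auto simp: profile_def intro!: exI[of _ 0])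
  qed (use that in \<open>auto intro: bdd_aboveI[where M=1]\<close>)
  then show ?thesis
    using pinv_nonneg[OF assms] by (auto simp: decreasing01_def)
qed

lemma le_pinv:
  assumes "0 \<le> x" "x \<le> 1" "y \<le> f x"
  shows "x \<le> pinv f y"
  unfolding pinv_def using assms
  by (intro cSup_upper) (auto intro: bdd_aboveI[where M=1])

text \<open>The supremum in \<open>pinv\<close> need not be attained, hence the strict inequality:
  some \<open>u\<close> beyond \<open>x\<close> has \<open>f u\<close> at least \<open>y\<close>,
  and \<open>f\<close> decreases.\<close>

lemma zext_ge_if_less_pinv:
  assumes "profile f" "0 < y" "0 \<le> x" "x < zext (pinv f) y"
  shows "y \<le> zext f x"
proof -
  have y: "y \<le> 1" and x: "x < pinv f y"
    using assms by (auto simp: zext_def split: if_splits)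
  have "{u \<in> {0..1}. y \<le> f u} \<noteq> {}"
    using y assms by (auto simp: profile_def intro!: exI[of _ 0])
  with x[unfolded pinv_def] obtain u where "u \<in> {u \<in> {0..1}. y \<le> f u}" "x < u"
    by (rule less_cSupE)
  then have "x < u" "u \<in> {0..1}" "y \<le> f u" by auto
  moreover from this have "f u \<le> f x"
    using assms by (auto simp: profile_def decreasing01_def)
  ultimately show ?thesis using assms by (auto simp: zext_def)
qed

lemma zext_less_if_pinv_less:
  assumes "profile f" "0 < y" "0 \<le> x" "zext (pinv f) y < x"
  shows "zext f x < y"
proof (cases "x \<le> 1 \<and> y \<le> 1")
  case True
  then have "\<not> y \<le> f x" using assms le_pinv[of x y f] by (auto simp: zext_def)
  with True assms show ?thesis by (auto simp: zext_def)
next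
  case False
  then show ?thesis using assms zext_le_1[OF assms(1), of x] by (auto simp: zext_def)
qed

lemma pinv_mono:
  assumes "profile f" "profile g" "\<And>x. 0 \<le> x \<Longrightarrow> x \<le> 1 \<Longrightarrow> g x \<le> f x" "0 \<le> y" "y \<le> 1"
  shows "pinv g y \<le> pinv f y"
  unfolding pinv_def
proof (rule cSup_subset_mono)
  show "{u \<in> {0..1}. y \<le> g u} \<noteq> {}"
    using assms by (auto simp: profile_def intro!: exI[of _ 0])
  show "{u \<in> {0..1}. y \<le> g u} \<subseteq> {u \<in> {0..1}. y \<le> f u}"
    using assms(3) by fastforce
qed (auto intro: bdd_aboveI[where M=1])

text \<open>The rectangle with corner \<open>(x, f x)\<close> lies under the graph of
  \<open>f\<close>; after reflection, \<open>pinv f\<close> is at least \<open>x\<close> on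
  \<open>{0..f x}\<close>.\<close>

lemma intI_pinv_lower:
  assumes "profile f" and x: "0 \<le> x" "x \<le> 1"
  shows "f x * x \<le> intI (pinv f)"
proof -
  have "0 \<le> f x" using assms by (auto simp: profile_def decreasing01_def)
  have fx: "f x \<le> 1" by (rule profile_le_1[OF assms(1)]) (use x in auto)
  have D: "decreasing01 (pinv f)" by (rule pinv_decreasing01[OF assms(1)])
  have "f x * x = integral {0..f x} (\<lambda>_. x)" using \<open>0 \<le> f x\<close> by simp
  also have "\<dots> \<le> integral {0..f x} (pinv f)"
    using x fx D by (intro integral_le decreasing01_integrable[of "pinv f"]) (auto intro: le_pinv)
  also have "\<dots> \<le> integral {0..1} (pinv f)"
    using x fx D assms(1) pinv_nonneg
    by (intro integral_subset_le decreasing01_integrable) auto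
  finally show ?thesis by (simp add: intI_def)
qed

lemma intI_pinv_pos:
  assumes "profile f"
  shows "0 < intI (pinv f)"
proof -
  obtain x where x: "0 < x" "x \<le> 1" "0 < f x" using assms by (auto simp: profile_def)
  then have "0 < f x * x" by simp
  also have "\<dots> \<le> intI (pinv f)" using assms x by (intro intI_pinv_lower) auto
  finally show ?thesis .
qed

lemma intI_pinv_le_1:
  assumes "profile f"
  shows "intI (pinv f) \<le> 1"
proof -
  have "pinv f integrable_on {0..1}"
    using assms by (intro decreasing01_integrable pinv_decreasing01) auto
  then have "intI (pinv f) \<le> integral {0..1::real} (\<lambda>_. 1::real)"
    unfolding intI_def by (rule integral_le) (auto simp: pinv_le_1 assms)
  then show ?thesis by simp
qed

subsection \<open>The operator\<close>

lemma Top_0: "profile f \<Longrightarrow> Top f 0 = 1"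
  using intI_pinv_pos[of f] by (simp add: Top_def Iop_def intI_def)

lemma Top_1: "Top f 1 = 0"
  by (simp add: Top_def Iop_def)

lemma Top_diff:
  assumes "profile f" "0 \<le> x" "x \<le> y" "y \<le> 1"
  shows "Top f x - Top f y = integral {x..y} (pinv f) / intI (pinv f)"
proof -
  have "integral {x..y} (pinv f) + integral {y..1} (pinv f) = integral {x..1} (pinv f)"
    using assms by (intro Henstock_Kurzweil_Integration.integral_combine decreasing01_integrable pinv_decreasing01) auto
  then have "integral {x..y} (pinv f) = integral {x..1} (pinv f) - integral {y..1} (pinv f)" by simp
  then show ?thesis by (simp add: Top_def Iop_def diff_divide_distrib)
qed

text \<open>Since \<open>pinv f\<close> takes values between 0 and 1, \<open>Top f\<close> decreases
  with slope at most \<open>1 / intI (pinv f)\<close> in absolute value.\<close>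

lemma Top_diff_bounds:
  assumes "profile f" "0 \<le> x" "x \<le> y" "y \<le> 1"
  shows "0 \<le> Top f x - Top f y" "Top f x - Top f y \<le> (y - x) / intI (pinv f)"
proof -
  have i: "pinv f integrable_on {x..y}"
    using assms by (intro decreasing01_integrable pinv_decreasing01) auto
  have "0 \<le> integral {x..y} (pinv f)"
    using assms i by (intro integral_nonneg) (auto intro: pinv_nonneg)
  moreover have "integral {x..y} (pinv f) \<le> integral {x..y} (\<lambda>_. 1)"
    using assms i by (intro integral_le) (auto intro: pinv_le_1)
  ultimately show "0 \<le> Top f x - Top f y" "Top f x - Top f y \<le> (y - x) / intI (pinv f)"
    using intI_pinv_pos[OF assms(1)] assms
    by (auto simp: Top_diff intro!: divide_right_mono)
qed

lemma Top_lower: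
  assumes "profile f" "0 \<le> x" "x \<le> 1"
  shows "1 - x / intI (pinv f) \<le> Top f x"
  using Top_diff_bounds(2)[OF assms(1), of 0 x] assms Top_0[of f] by simp

lemma Top_profile:
  assumes "profile f"
  shows "profile (Top f)"
proof -
  have a: "Top f y \<le> Top f x" if "0 \<le> x" "x \<le> y" "y \<le> 1" for x y
    using Top_diff_bounds(1)[OF assms that] by simp
  define t where "t = intI (pinv f)"
  have t: "0 < t" "t \<le> 1" using assms by (auto simp: t_def intI_pinv_pos intI_pinv_le_1)
  \<comment> \<open>At \<open>t/2\<close> the Lipschitz bound leaves at least the value 1/2.\<close>
  have "1 - (t/2) / t \<le> Top f (t/2)"
    unfolding t_def by (rule Top_lower[OF assms]) (use t in \<open>auto simp: t_def\<close>)
  with t have "0 < Top f (t/2)" by (auto simp: field_simps)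
  with t have "\<exists>x\<in>{0<..1}. 0 < Top f x" by (intro bexI[of _ "t/2"]) auto
  moreover have "0 \<le> Top f x" if "0 \<le> x" "x \<le> 1" for x using a[OF that] Top_1[of f] by simp
  ultimately show ?thesis
    using a Top_0[OF assms] by (auto simp: profile_def decreasing01_def)
qed

text \<open>The free upper limit \<open>M\<close> lets two functions with supports of different
  length be written as integrals over the same interval.\<close>

lemma zext_Top_eq:
  assumes "profile f" "0 \<le> x" "x \<le> M" "1 \<le> M"
  shows "zext (Top f) x = integral {x..M} (zext (pinv f)) / intI (pinv f)"
proof -
  have D: "decreasing01 (pinv f)" by (rule pinv_decreasing01[OF assms(1)])
  have 0: "integral {u..M} (zext (pinv f)) = 0" if "1 \<le> u" for u
  proof -
    have "integral {u<..<M} (zext (pinv f)) = integral {u<..<M} (\<lambda>_. 0)"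
      using that by (intro integral_cong) (auto simp: zext_def)
    then show ?thesis by (simp add: integral_open_interval_real)
  qed
  show ?thesis
  proof (cases "x \<le> 1")
    case True
    have "integral {x..1} (zext (pinv f)) + integral {1..M} (zext (pinv f)) = integral {x..M} (zext (pinv f))"
      using assms True D by (intro Henstock_Kurzweil_Integration.integral_combine zext_integrable) auto
    moreover have "integral {x..1} (zext (pinv f)) = integral {x..1} (pinv f)"
      using assms by (intro integral_cong) (auto simp: zext_def)
    ultimately show ?thesis using 0[of 1] True assms by (simp add: zext_def Top_def Iop_def)
  next
    case False
    then show ?thesis using 0[of x] by (simp add: zext_def)
  qed
qed

text \<open>Substituting \<open>t / a\<close> in the integral for \<open>g\<close> shows that the
  integrand is again a difference of rescalings: the horizontal scale \<open>a\<close> stays, and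
  \<open>b\<close> changes to account for the two normalisations and the factor
  \<open>a\<close>.\<close>

lemma zext_Top_diff_eq:
  assumes f: "profile f" and g: "profile g" and a: "0 < a"
    and x: "0 \<le> x" "x \<le> M" and M: "1 \<le> M" "a \<le> M"
  shows "zext (Top f) x - b * zext (Top g) (x / a) =
    integral {x..M} (\<lambda>t. zext (pinv f) t - (b * intI (pinv f) / (intI (pinv g) * a)) * zext (pinv g) (t / a))
      / intI (pinv f)"
    and "(\<lambda>t. zext (pinv f) t - (b * intI (pinv f) / (intI (pinv g) * a)) * zext (pinv g) (t / a))
      integrable_on {x..M}"
proof -
  define k where "k = b * intI (pinv f) / (intI (pinv g) * a)"
  note D = f[THEN pinv_decreasing01] g[THEN pinv_decreasing01]
  note P = f[THEN intI_pinv_pos] g[THEN intI_pinv_pos]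
  have img: "(\<lambda>t. t / (1/a)) ` {x/a..M/a} = {x..M}"
  proof -
    have "(\<lambda>t. t / (1/a)) ` {x/a..M/a} = (*) a ` {x/a..M/a}" by (simp add: mult.commute)
    also have "\<dots> = {x..M}" using a x by (simp add: image_mult_atLeastAtMost divide_right_mono)
    finally show ?thesis .
  qed
  have i1: "zext (pinv f) integrable_on {x..M}" using D x by (intro zext_integrable) auto
  have ig: "zext (pinv g) integrable_on {x/a..M/a}" using D x a by (intro zext_integrable) auto
  have i2: "(\<lambda>t. zext (pinv g) (t / a)) integrable_on {x..M}"
    using integrable_stretch_real[OF ig, of "1/a"] a unfolding img by simp
  have s: "integral {x..M} (\<lambda>t. zext (pinv g) (t / a)) = a * integral {x/a..M/a} (zext (pinv g))"
    using integral_stretch_real[of "1/a" "x/a" "M/a" "zext (pinv g)"] a unfolding img by simp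
  show i: "(\<lambda>t. zext (pinv f) t - (b * intI (pinv f) / (intI (pinv g) * a)) * zext (pinv g) (t / a))
      integrable_on {x..M}"
    by (intro integrable_diff i1 integrable_on_mult_right i2)
  have "integral {x..M} (\<lambda>t. zext (pinv f) t - k * zext (pinv g) (t / a))
     = integral {x..M} (zext (pinv f)) - k * (a * integral {x/a..M/a} (zext (pinv g)))"
    by (simp add: integral_diff[OF i1 integrable_on_mult_right[OF i2]] s)
  moreover have "zext (Top f) x = integral {x..M} (zext (pinv f)) / intI (pinv f)"
    using f x M by (intro zext_Top_eq) auto
  moreover have "zext (Top g) (x/a) = integral {x/a..M/a} (zext (pinv g)) / intI (pinv g)"
    using g x M a by (intro zext_Top_eq) (auto simp: divide_right_mono)
  ultimately show "zext (Top f) x - b * zext (Top g) (x / a) =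
    integral {x..M} (\<lambda>t. zext (pinv f) t - (b * intI (pinv f) / (intI (pinv g) * a)) * zext (pinv g) (t / a))
      / intI (pinv f)"
    using a P unfolding k_def[symmetric] by (simp add: k_def field_simps)
qed

subsection \<open>Crossings\<close>

text \<open>
  The difference f(x) - b g(x/a) does not take the signs +, -, + in this order; in the second
  definition b = 1 and the excluded pattern is -, +.
\<close>

definition no_down_up :: "(real \<Rightarrow> real) \<Rightarrow> (real \<Rightarrow> real) \<Rightarrow> bool" where
  "no_down_up f g \<longleftrightarrow> (\<forall>a>0. \<forall>b>0. \<forall>x y z. 0 < x \<longrightarrow> x < y \<longrightarrow> y < z \<longrightarrow>
     b * zext g (x / a) < zext f x \<longrightarrow> zext f y < b * zext g (y / a) \<longrightarrow>
     zext f z \<le> b * zext g (z / a))"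

definition no_up :: "(real \<Rightarrow> real) \<Rightarrow> (real \<Rightarrow> real) \<Rightarrow> bool" where
  "no_up f g \<longleftrightarrow> (\<forall>a>0. \<forall>x y. 0 < x \<longrightarrow> x < y \<longrightarrow>
     zext f x < zext g (x / a) \<longrightarrow> zext f y \<le> zext g (y / a))"

text \<open>Once the rescaled decreasing function is below the box, it stays below height 1. The
  difference can then turn negative only beyond 1, where the box is zero for good.\<close>

lemma no_down_up_const_1:
  assumes "profile f"
  shows "no_down_up (\<lambda>_. 1) f"
  unfolding no_down_up_def
proof (intro allI impI)
  fix a b x y z :: real
  assume *: "0 < a" "0 < b" "0 < x" "x < y" "y < z"
    "b * zext f (x / a) < zext (\<lambda>_. 1) x" "zext (\<lambda>_. 1) y < b * zext f (y / a)"
  have f: "decreasing01 f" using assms by (rule profile_decreasing01)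
  have "zext f (y / a) \<le> zext f (x / a)"
    using * by (intro zext_antimono[OF f]) (auto simp: divide_right_mono)
  then have "b * zext f (y / a) \<le> b * zext f (x / a)" using * by simp
  moreover have "zext (\<lambda>_. 1) x \<le> 1" by (simp add: zext_def)
  ultimately have "zext (\<lambda>_. 1) y < 1" using * by linarith
  then have "1 < y" using * by (auto simp: zext_def split: if_splits)
  then have "zext (\<lambda>_. 1) z = 0" using * by (simp add: zext_def)
  then show "zext (\<lambda>_. 1) z \<le> b * zext f (z / a)" using zext_nonneg[OF f] * by simp
qed

lemma no_up_const_1:
  assumes "profile f"
  shows "no_up (\<lambda>_. 1) f"
  unfolding no_up_def
proof (intro allI impI)
  fix a x y :: real
  assume *: "0 < a" "0 < x" "x < y" "zext (\<lambda>_. 1) x < zext f (x / a)"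
  have "zext f (x / a) \<le> 1" by (rule zext_le_1[OF assms])
  then have "1 < x" using * by (auto simp: zext_def[of "\<lambda>_. 1"] split: if_splits)
  then have "zext (\<lambda>_. 1) y = 0" using * by (simp add: zext_def)
  then show "zext (\<lambda>_. 1) y \<le> zext f (y / a)"
    using zext_nonneg[OF profile_decreasing01[OF assms]] by simp
qed

text \<open>Any \<open>x\<close> strictly between the two values of the pseudo-inverses works. The
  sign at \<open>y\<close> becomes the same sign at \<open>x\<close> with \<open>a\<close> and
  \<open>b\<close> exchanged, and \<open>y\<close> separates the two values at \<open>x\<close>;
  this later determines the order of several such points.\<close>

lemma pinv_greater_point:
  assumes "profile f" "profile g" "0 < a" "0 < b" "0 < y"
    and "b * zext (pinv g) (y / a) < zext (pinv f) y"
  obtains x where "0 < x" "y \<le> zext f x" "a * zext g (x / b) < y"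
proof -
  obtain x where x: "b * zext (pinv g) (y / a) < x" "x < zext (pinv f) y"
    using dense[OF assms(6)] by blast
  have "0 \<le> b * zext (pinv g) (y / a)"
    using assms by (simp add: zext_nonneg pinv_decreasing01)
  then have x0: "0 < x" using x by simp
  have "y \<le> zext f x" using assms x x0 by (intro zext_ge_if_less_pinv) auto
  moreover have "zext (pinv g) (y / a) < x / b"
    using x(1) assms(4) by (simp add: pos_less_divide_eq mult.commute)
  then have "zext g (x / b) < y / a"
    by (rule zext_less_if_pinv_less[OF assms(2), rotated 2]) (use assms x0 in auto)
  then have "a * zext g (x / b) < y"
    using assms(3) by (simp add: pos_less_divide_eq mult.commute)
  ultimately show thesis using that[of x] x0 by blast
qed

lemma pinv_less_point:
  assumes "profile f" "profile g" "0 < a" "0 < b" "0 < y"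
    and "zext (pinv f) y < b * zext (pinv g) (y / a)"
  obtains x where "0 < x" "zext f x < y" "y \<le> a * zext g (x / b)"
proof -
  obtain x where x: "zext (pinv f) y < x" "x < b * zext (pinv g) (y / a)"
    using dense[OF assms(6)] by blast
  have "0 \<le> zext (pinv f) y"
    using assms by (simp add: zext_nonneg pinv_decreasing01)
  then have x0: "0 < x" using x by simp
  have "zext f x < y" using zext_less_if_pinv_less[OF assms(1,5) _ x(1)] x0 by simp
  moreover have "x / b < zext (pinv g) (y / a)"
    using x(2) assms(4) by (simp add: pos_divide_less_eq mult.commute)
  then have "y / a \<le> zext g (x / b)"
    by (rule zext_ge_if_less_pinv[OF assms(2), rotated 2]) (use assms x0 in auto)
  then have "y \<le> a * zext g (x / b)"
    using assms(3) by (simp add: pos_divide_le_eq mult.commute)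
  ultimately show thesis using that[of x] x0 by blast
qed

lemma zext_less_imp_less:
  assumes "decreasing01 f" "0 \<le> x" "zext f x < zext f y"
  shows "y < x"
  using zext_antimono[OF assms(1,2), of y] assms(3) by linarith

lemma zext_scaled_less_imp_less:
  assumes "decreasing01 f" "0 \<le> x" "0 < a" "0 < b" "a * zext f (x / b) < a * zext f (y / b)"
  shows "y < x"
  using zext_less_imp_less[of f "x / b" "y / b"] assms by (auto simp: divide_less_cancel)

text \<open>Points with signs +, -, + for the pseudo-inverses give points with the same signs for
  the original functions in reversed order, and this pattern is its own reversal.\<close>

lemma no_down_up_pinv:
  assumes f: "profile f" and g: "profile g" and A: "no_down_up f g"
  shows "no_down_up (pinv f) (pinv g)"
  unfolding no_down_up_def
proof (intro allI impI, rule ccontr)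
  fix a b y1 y2 y3 :: real
  assume *: "0 < a" "0 < b" "0 < y1" "y1 < y2" "y2 < y3"
    "b * zext (pinv g) (y1 / a) < zext (pinv f) y1" "zext (pinv f) y2 < b * zext (pinv g) (y2 / a)"
    "\<not> zext (pinv f) y3 \<le> b * zext (pinv g) (y3 / a)"
  obtain x1 where x1: "0 < x1" "y1 \<le> zext f x1" "a * zext g (x1 / b) < y1"
    by (rule pinv_greater_point[OF f g, of a b y1]) (use * in auto)
  obtain x2 where x2: "0 < x2" "zext f x2 < y2" "y2 \<le> a * zext g (x2 / b)"
    by (rule pinv_less_point[OF f g, of a b y2]) (use * in auto)
  obtain x3 where x3: "0 < x3" "y3 \<le> zext f x3" "a * zext g (x3 / b) < y3"
    by (rule pinv_greater_point[OF f g, of a b y3]) (use * in auto)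
  have "a * zext g (x1 / b) < a * zext g (x2 / b)" using x1 x2 * by linarith
  then have "x2 < x1"
    using zext_scaled_less_imp_less[OF profile_decreasing01[OF g]] x1 * by auto
  moreover have "x3 < x2"
    by (rule zext_less_imp_less[of f]) (use f x3 x2 * in \<open>auto simp: profile_def\<close>)
  ultimately have "zext f x1 \<le> a * zext g (x1 / b)"
    using A[unfolded no_down_up_def, rule_format, of b a x3 x2 x1] * x1 x2 x3 by linarith
  with x1 show False by linarith
qed

text \<open>Reversal turns the excluded pattern -, + into +, -. The vertical factor 1 in
  \<open>no_up\<close> becomes the horizontal scale of \<open>pinv g\<close>, while \<open>b\<close>
  becomes its vertical factor.\<close>

lemma no_up_pinv:
  assumes f: "profile f" and g: "profile g" and B: "no_up f g"
    and *: "0 < b" "0 < y1" "y1 < y2" "b * zext (pinv g) y1 < zext (pinv f) y1"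
  shows "b * zext (pinv g) y2 \<le> zext (pinv f) y2"
proof (rule ccontr)
  assume n: "\<not> b * zext (pinv g) y2 \<le> zext (pinv f) y2"
  obtain x1 where x1: "0 < x1" "y1 \<le> zext f x1" "1 * zext g (x1 / b) < y1"
    by (rule pinv_greater_point[OF f g, of 1 b y1]) (use * in auto)
  obtain x2 where x2: "0 < x2" "zext f x2 < y2" "y2 \<le> 1 * zext g (x2 / b)"
    by (rule pinv_less_point[OF f g, of 1 b y2]) (use * n in auto)
  have "1 * zext g (x1 / b) < 1 * zext g (x2 / b)" using x1 x2 * by linarith
  then have "x2 < x1"
    using zext_scaled_less_imp_less[OF profile_decreasing01[OF g], of x1 1 b x2] x1 * by simp
  then have "zext f x1 \<le> zext g (x1 / b)"
    using B[unfolded no_up_def, rule_format, of b x2 x1] * x1 x2 by linarith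
  with x1 show False by linarith
qed

text \<open>Up to a positive factor, the difference \<open>D\<close> is the integral of
  \<open>d\<close> from \<open>x\<close> to the right end. A drop of \<open>D\<close> needs a point
  with \<open>d\<close> positive, a rise one with \<open>d\<close> negative, and a positive value
  one with \<open>d\<close> positive further right, since \<open>D\<close> ends at 0. So +, -, + for
  \<open>D\<close> forces +, -, + for \<open>d\<close>. For \<open>b = 1\<close> also
  \<open>D\<close> starts at 0, so -, + already forces this pattern.\<close>

lemma
  assumes f: "profile f" and g: "profile g" and A: "no_down_up f g"
  shows no_down_up_Top: "no_down_up (Top f) (Top g)" and no_up_Top: "no_up (Top f) (Top g)"
proof -
  define k where "k a b = b * intI (pinv f) / (intI (pinv g) * a)" for a b
  define d where "d a b = (\<lambda>t. zext (pinv f) t - k a b * zext (pinv g) (t / a))" for a b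
  define D where "D a b x = zext (Top f) x - b * zext (Top g) (x / a)" for a b x
  note P = f[THEN intI_pinv_pos] g[THEN intI_pinv_pos]
  have ndu: "d a b z \<le> 0"
    if "0 < a" "0 < b" "0 < x" "x < y" "y < z" "0 < d a b x" "d a b y < 0" for a b x y z
  proof -
    have "0 < k a b" using that P by (simp add: k_def)
    then show ?thesis
      using no_down_up_pinv[OF f g A, unfolded no_down_up_def, rule_format, of a "k a b" x y z] that
      by (simp add: d_def)
  qed
  have D: "D a b x = integral {x..max 1 a} (d a b) / intI (pinv f)"
    and i: "d a b integrable_on {x..max 1 a}"
    if "0 < a" "0 \<le> x" "x \<le> max 1 a" for a b x
    using zext_Top_diff_eq[OF f g that, of b] unfolding d_def D_def k_def by simp_all
  have D0: "D a b x = 0" if "0 < a" "max 1 a \<le> x" for a b x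
    using that by (auto simp: D_def zext_def Top_1)
  have Dd: "(D a b x - D a b y) * intI (pinv f) = integral {x..y} (d a b)" "d a b integrable_on {x..y}"
    if "0 < a" "0 \<le> x" "x \<le> y" "y \<le> max 1 a" for a b x y
  proof -
    show "d a b integrable_on {x..y}"
      by (rule integrable_subinterval_real[OF i[of a x b]]) (use that in auto)
    have "integral {x..y} (d a b) + integral {y..max 1 a} (d a b) = integral {x..max 1 a} (d a b)"
      using that i[of a x b] by (intro Henstock_Kurzweil_Integration.integral_combine) auto
    then have "integral {x..y} (d a b) = integral {x..max 1 a} (d a b) - integral {y..max 1 a} (d a b)"
      by simp
    then show "(D a b x - D a b y) * intI (pinv f) = integral {x..y} (d a b)"
      using that P by (simp add: D diff_divide_distrib[symmetric])
  qed
  have pos: "\<exists>t. x < t \<and> t < y \<and> 0 < d a b t"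
    if "0 < a" "0 \<le> x" "x < y" "y \<le> max 1 a" "D a b y < D a b x" for a b x y
  proof -
    have "0 < integral {x..y} (d a b)"
      using Dd(1)[of a x y b] that P by (metis diff_gt_0_iff_gt less_imp_le mult_pos_pos)
    then show ?thesis using integral_pos_imp_pos_point[OF Dd(2)[of a x y b]] that by (metis less_imp_le)
  qed
  have neg: "\<exists>t. x < t \<and> t < y \<and> d a b t < 0"
    if "0 < a" "0 \<le> x" "x < y" "y \<le> max 1 a" "D a b x < D a b y" for a b x y
  proof -
    have "integral {x..y} (d a b) < 0"
      using Dd(1)[of a x y b] that P by (metis diff_less_0_iff_less less_imp_le mult_neg_pos)
    then show ?thesis using integral_neg_imp_neg_point[OF Dd(2)[of a x y b]] that by (metis less_imp_le)
  qed
  have less_max: "z < max 1 a" if "0 < a" "0 < D a b z" for a b z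
    using D0[of a z b] that by (cases "max 1 a \<le> z") auto
  have last: "\<exists>t. z < t \<and> 0 < d a b t" if "0 < a" "0 \<le> z" "0 < D a b z" for a b z
    using pos[of a z "max 1 a" b] D0[of a "max 1 a" b] less_max[of a b z] that by auto
  show "no_down_up (Top f) (Top g)"
    unfolding no_down_up_def
  proof (intro allI impI, rule ccontr)
    fix a b x y z :: real
    assume *: "0 < a" "0 < b" "0 < x" "x < y" "y < z"
      "b * zext (Top g) (x / a) < zext (Top f) x" "zext (Top f) y < b * zext (Top g) (y / a)"
      "\<not> zext (Top f) z \<le> b * zext (Top g) (z / a)"
    then have D: "0 < D a b x" "D a b y < 0" "0 < D a b z" by (auto simp: D_def)
    have z: "z < max 1 a" using less_max D * by blast
    obtain t where t: "x < t" "t < y" "0 < d a b t" using pos[of a x y b] * D z by auto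
    obtain u where u: "y < u" "u < z" "d a b u < 0" using neg[of a y z b] * D z by auto
    obtain v where v: "z < v" "0 < d a b v" using last[of a z b] * D by auto
    show False using ndu[of a b t u v] * t u v by linarith
  qed
  show "no_up (Top f) (Top g)"
    unfolding no_up_def
  proof (intro allI impI, rule ccontr)
    fix a x y :: real
    assume *: "0 < a" "0 < x" "x < y" "zext (Top f) x < zext (Top g) (x / a)"
      "\<not> zext (Top f) y \<le> zext (Top g) (y / a)"
    then have D: "D a 1 x < 0" "0 < D a 1 y" by (auto simp: D_def)
    have D0: "D a 1 0 = 0" using f g by (simp add: D_def zext_def Top_0)
    have y: "y < max 1 a" using less_max D * by blast
    obtain t where t: "0 < t" "t < x" "0 < d a 1 t" using pos[of a 0 x 1] * D D0 y by auto
    obtain u where u: "x < u" "u < y" "d a 1 u < 0" using neg[of a x y 1] * D y by auto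
    obtain v where v: "y < v" "0 < d a 1 v" using last[of a y 1] * D by auto
    show False using ndu[of a 1 t u v] * t u v by linarith
  qed
qed

text \<open>For \<open>b < 1\<close> the normalisation makes the total integral of \<open>d\<close>
  positive. A negative integral over \<open>{x..1}\<close> would make the one over
  \<open>{0..x}\<close> positive, so \<open>d\<close> would be positive and later negative, against
  \<open>no_up_pinv\<close>. Then \<open>b\<close> tends to 1.\<close>

lemma Top_mono_if_no_up:
  assumes f: "profile f" and g: "profile g" and B: "no_up f g" and x: "0 \<le> x" "x \<le> 1"
  shows "Top g x \<le> Top f x"
proof -
  have "b * Top g x \<le> Top f x" if b: "0 < b" "b < 1" for b
  proof (rule ccontr)
    assume n: "\<not> b * Top g x \<le> Top f x"
    define k where "k = b * intI (pinv f) / (intI (pinv g) * 1)"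
    define d where "d = (\<lambda>t. zext (pinv f) t - k * zext (pinv g) (t / 1))"
    note P = f[THEN intI_pinv_pos] g[THEN intI_pinv_pos]
    have k: "0 < k" using P b by (simp add: k_def)
    have i: "d integrable_on {0..1}" "d integrable_on {x..1}"
      using zext_Top_diff_eq(2)[OF f g, of 1 _ 1 b] x unfolding d_def k_def by auto
    have ix: "d integrable_on {0..x}" by (rule integrable_subinterval_real[OF i(1)]) (use x in auto)
    have "1 - b = integral {0..1} d / intI (pinv f)"
      using zext_Top_diff_eq(1)[OF f g, of 1 0 1 b] f g unfolding k_def[symmetric] d_def[symmetric]
      by (simp add: zext_def Top_0)
    then have "0 < integral {0..1} d" using b P by (metis diff_gt_0_iff_gt zero_less_divide_iff less_asym)
    moreover have "Top f x - b * Top g x = integral {x..1} d / intI (pinv f)"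
      using zext_Top_diff_eq(1)[OF f g, of 1 x 1 b] x unfolding k_def[symmetric] d_def[symmetric]
      by (simp add: zext_def)
    then have "integral {x..1} d / intI (pinv f) < 0" using n by linarith
    then have neg: "integral {x..1} d < 0" using P by (simp add: divide_less_0_iff)
    moreover have "integral {0..x} d + integral {x..1} d = integral {0..1} d"
      using x i by (intro Henstock_Kurzweil_Integration.integral_combine) auto
    ultimately have pos: "0 < integral {0..x} d" by linarith
    obtain t where t: "0 < t" "t < x" "0 < d t" using integral_pos_imp_pos_point[OF ix pos] by blast
    obtain u where u: "x < u" "u < 1" "d u < 0" using integral_neg_imp_neg_point[OF i(2) neg] by blast
    show False using no_up_pinv[OF f g B k, of t u] t u by (auto simp: d_def)
  qed
  then have "eventually (\<lambda>b. b * Top g x \<le> Top f x) (at_left 1)"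
    unfolding eventually_at_left_field by (intro exI[of _ 0]) auto
  moreover have "((\<lambda>b. b * Top g x) \<longlongrightarrow> 1 * Top g x) (at_left 1)"
    by (intro tendsto_intros)
  ultimately have "1 * Top g x \<le> Top f x" by (intro tendsto_upperbound) auto
  then show ?thesis by simp
qed

text \<open>Positivity of \<open>f\<close> before 1 makes \<open>pinv f\<close> tend to 1 at 0, so
  \<open>Top f\<close> starts with slope \<open>- 1 / intI (pinv f)\<close>. For
  \<open>a > r\<close> it therefore falls below the graph of \<open>Top g\<close> stretched by
  \<open>a\<close> immediately after 0, and by \<open>no_up\<close> it never rises above it later.
  Pseudo-inverses and integration turn this into the bound, with \<open>a\<close> tending to
  \<open>r\<close>.\<close>

lemma Top_ratio_bound:
  assumes f: "profile f" and g: "profile g" and pos: "\<And>x. 0 \<le> x \<Longrightarrow> x < 1 \<Longrightarrow> 0 < f x"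
    and B: "no_up (Top f) (Top g)" and x: "0 \<le> x" "x \<le> 1"
  shows "Top (Top f) x \<le>
    (intI (pinv (Top g)) / intI (pinv (Top f))) / (intI (pinv g) / intI (pinv f)) * Top (Top g) x"
proof -
  note P = f[THEN intI_pinv_pos] g[THEN intI_pinv_pos]
  note TP = f[THEN Top_profile] g[THEN Top_profile]
  note Q = TP(1)[THEN intI_pinv_pos] TP(2)[THEN intI_pinv_pos]
  define r where "r = intI (pinv f) / intI (pinv g)"
  have r: "0 < r" using P by (simp add: r_def)
  have pinv_le: "pinv (Top f) y \<le> a * pinv (Top g) y" if a: "r < a" and y: "0 < y" "y < 1" for a y
  proof (rule ccontr)
    assume n: "\<not> pinv (Top f) y \<le> a * pinv (Top g) y"
    have a0: "0 < a" using a r by linarith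
    obtain z where z: "0 < z" "y \<le> zext (Top f) z" "1 * zext (Top g) (z / a) < y"
      by (rule pinv_greater_point[OF TP, of 1 a y]) (use n y a0 in \<open>auto simp: zext_def\<close>)
    \<comment> \<open>A height strictly between \<open>r / a\<close> and 1, so that a lower bound
      \<open>\<theta>\<close> for \<open>pinv f\<close> near 0 still beats the slope of the
      stretched \<open>Top g\<close>.\<close>
    define \<theta> where "\<theta> = (1 + r / a) / 2"
    have \<theta>: "0 < \<theta>" "\<theta> < 1" "r / a < \<theta>" using r a a0 by (auto simp: \<theta>_def field_simps)
    \<comment> \<open>\<open>w\<close> lies before \<open>z\<close> so that \<open>no_up\<close>
      applies, below \<open>f \<theta>\<close> so that \<open>pinv f\<close> is at least
      \<open>\<theta>\<close> on \<open>{0..w}\<close>, and below \<open>a\<close> and 1 so that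
      \<open>w / a\<close> and \<open>w\<close> stay in the unit interval.\<close>
    define w where "w = Min {z / 2, f \<theta>, a, 1}"
    have w: "0 < w" "w < z" "w \<le> f \<theta>" "w \<le> a" "w \<le> 1"
      using z pos[of \<theta>] \<theta> a0 by (auto simp: w_def min_def)
    have "w * \<theta> = integral {0..w} (\<lambda>_. \<theta>)" using w by simp
    also have "\<dots> \<le> integral {0..w} (pinv f)"
      using w \<theta> f
      by (intro integral_le decreasing01_integrable[OF pinv_decreasing01[OF f]]) (auto intro!: le_pinv)
    finally have "w * \<theta> / intI (pinv f) \<le> 1 - Top f w"
      using Top_diff[OF f, of 0 w] w P by (simp add: Top_0[OF f] divide_right_mono)
    moreover have "1 - (w / a) / intI (pinv g) \<le> Top g (w / a)"
      using w a0 by (intro Top_lower[OF g]) auto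
    moreover have "(w / a) / intI (pinv g) < w * \<theta> / intI (pinv f)"
    proof -
      have "(w / a) / intI (pinv g) = w * (r / a) / intI (pinv f)" using P by (simp add: r_def)
      also have "\<dots> < w * \<theta> / intI (pinv f)"
        using P w \<theta> by (intro divide_strict_right_mono mult_strict_left_mono) auto
      finally show ?thesis .
    qed
    ultimately have "Top f w < Top g (w / a)" by linarith
    then have "zext (Top f) w < zext (Top g) (w / a)" using w a0 by (simp add: zext_def)
    then have "zext (Top f) z \<le> zext (Top g) (z / a)"
      using B[unfolded no_up_def, rule_format, of a w z] a0 w by blast
    with z show False by linarith
  qed
  have bound: "Top (Top f) x \<le> a * (intI (pinv (Top g)) / intI (pinv (Top f)) * Top (Top g) x)"
    if "r < a" for a
  proof -
    have i: "pinv (Top f) integrable_on {x..1}" "pinv (Top g) integrable_on {x..1}"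
      using x by (intro decreasing01_integrable pinv_decreasing01 TP; simp)+
    \<comment> \<open>The open interval is used because \<open>pinv_le\<close> covers only
      \<open>0 < y < 1\<close>.\<close>
    have "integral {x<..<1} (pinv (Top f)) \<le> integral {x<..<1} (\<lambda>y. a * pinv (Top g) y)"
      using i pinv_le[OF that] x
      by (intro integral_le integrable_on_mult_right) (auto simp: integrable_on_Icc_iff_Ioo)
    then have "integral {x..1} (pinv (Top f)) \<le> a * integral {x..1} (pinv (Top g))"
      by (simp add: integral_open_interval_real)
    then have "integral {x..1} (pinv (Top f)) / intI (pinv (Top f))
        \<le> a * integral {x..1} (pinv (Top g)) / intI (pinv (Top f))"
      using Q by (intro divide_right_mono) auto
    then show ?thesis using Q by (simp add: Top_def[of "Top f"] Top_def[of "Top g"] Iop_def)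
  qed
  have "eventually (\<lambda>a. Top (Top f) x \<le> a * (intI (pinv (Top g)) / intI (pinv (Top f)) * Top (Top g) x)) (at_right r)"
    unfolding eventually_at_right_field using bound by (intro exI[of _ "r + 1"]) auto
  moreover have "((\<lambda>a. a * (intI (pinv (Top g)) / intI (pinv (Top f)) * Top (Top g) x)) \<longlongrightarrow>
      r * (intI (pinv (Top g)) / intI (pinv (Top f)) * Top (Top g) x)) (at_right r)"
    by (intro tendsto_intros)
  ultimately have "Top (Top f) x \<le> r * (intI (pinv (Top g)) / intI (pinv (Top f)) * Top (Top g) x)"
    by (intro tendsto_lowerbound) auto
  then show ?thesis by (simp add: r_def mult_ac)
qed

subsection \<open>Iteration\<close>

lemma Top_ge_rectangle:
  assumes "profile f" "0 \<le> x" "x \<le> y" "y \<le> 1"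
  shows "(y - x) * pinv f y / intI (pinv f) \<le> Top f x"
proof -
  have D: "decreasing01 (pinv f)" by (rule pinv_decreasing01[OF assms(1)])
  have "(y - x) * pinv f y = integral {x..y} (\<lambda>_. pinv f y)" using assms by simp
  also have "\<dots> \<le> integral {x..y} (pinv f)"
  proof (rule integral_le)
    show "pinv f integrable_on {x..y}" using assms D by (intro decreasing01_integrable) auto
  qed (use assms D in \<open>auto simp: decreasing01_def\<close>)
  finally have "(y - x) * pinv f y / intI (pinv f) \<le> Top f x - Top f y"
    using intI_pinv_pos[OF assms(1)] by (simp add: Top_diff[OF assms] divide_right_mono)
  moreover have "0 \<le> Top f y"
    using Top_profile[OF assms(1)] assms by (auto simp: profile_def decreasing01_def)
  ultimately show ?thesis by linarith
qed

text \<open>Values of \<open>f\<close> close to 1 at positive points make \<open>pinv f\<close>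
  positive before 1; the rectangle up to the midpoint of \<open>x\<close> and 1 then has positive
  area.\<close>

lemma Top_pos:
  assumes "profile f" and "\<And>y. y < 1 \<Longrightarrow> \<exists>u\<in>{0<..1}. y \<le> f u" and "0 \<le> x" "x < 1"
  shows "0 < Top f x"
proof -
  obtain u where u: "0 < u" "u \<le> 1" "(1 + x) / 2 \<le> f u"
    using assms(2)[of "(1 + x) / 2"] assms(4) by auto
  then have "0 < pinv f ((1 + x) / 2)" using le_pinv[of u "(1 + x) / 2" f] by linarith
  then have "0 < ((1 + x) / 2 - x) * pinv f ((1 + x) / 2) / intI (pinv f)"
    using assms intI_pinv_pos[OF assms(1)] by (intro divide_pos_pos mult_pos_pos) auto
  also have "\<dots> \<le> Top f x" using assms by (intro Top_ge_rectangle) auto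
  finally show ?thesis .
qed

text \<open>\<open>Top f\<close> lies above the line from height 1 at 0 to height 0 at
  \<open>intI (pinv f)\<close>; the bound is the inverse of this line.\<close>

lemma pinv_Top_ge:
  assumes "profile f" "0 \<le> y" "y \<le> 1"
  shows "intI (pinv f) * (1 - y) \<le> pinv (Top f) y"
proof (rule le_pinv)
  note P = intI_pinv_pos[OF assms(1)] intI_pinv_le_1[OF assms(1)]
  show *: "0 \<le> intI (pinv f) * (1 - y)" "intI (pinv f) * (1 - y) \<le> 1"
    using P assms by (auto intro: mult_le_one)
  show "y \<le> Top f (intI (pinv f) * (1 - y))"
    using Top_lower[OF assms(1) *] P by simp
qed

section \<open>Admissible starting functions and comparison of their iterates\<close>

lemma profile_const_1: "profile (\<lambda>_. 1)"
  by (auto simp: profile_def decreasing01_def intro!: exI[of _ 1])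

lemma classE_profile:
  assumes "f \<in> classE"
  shows "profile f"
proof -
  have "\<exists>x\<in>{0<..1}. 0 < f x"
  proof (rule ccontr)
    assume "\<not> ?thesis"
    then have "f x \<le> 0" if "x \<in> {0<..<1}" for x using that by (auto simp: not_less)
    moreover have "0 \<le> f x" if "x \<in> {0<..<1}" for x using assms that by (auto simp: classE_def)
    ultimately have "f x = 0" if "x \<in> {0<..<1}" for x using that by (metis order_antisym)
    then have "integral {0<..<1} f = integral {0<..<1::real} (\<lambda>_. 0)" by (intro integral_cong) auto
    then show False using assms by (simp add: classE_def intI_def integral_open_interval_real)
  qed
  with assms show ?thesis by (auto simp: classE_def profile_def decreasing01_def)
qed

lemma funpow_Top_profile: "profile f \<Longrightarrow> profile ((Top ^^ n) f)"
  by (induction n) (auto intro: Top_profile)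

lemma hseq_Suc: "hseq (Suc n) = Top (hseq n)"
  by (simp add: hseq_def)

lemma hseq_0: "hseq 0 = (\<lambda>_. 1)"
  by (simp add: hseq_def)

lemma hseq_profile: "profile (hseq n)"
  unfolding hseq_def by (rule funpow_Top_profile[OF profile_const_1])

lemma hseq_near_0:
  assumes "y < 1"
  shows "\<exists>u\<in>{0<..1}. y \<le> hseq n u"
proof (cases n)
  case 0
  then show ?thesis using assms by (intro bexI[of _ 1]) (auto simp: hseq_0)
next
  case (Suc m)
  define t where "t = intI (pinv (hseq m))"
  have t: "0 < t" "t \<le> 1" unfolding t_def by (simp_all add: intI_pinv_pos intI_pinv_le_1 hseq_profile)
  define u where "u = t * (1 - max y 0)"
  have u: "0 < u" "u \<le> 1" using t assms by (auto simp: u_def intro!: mult_le_one)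
  have "1 - u / t \<le> hseq n u"
    unfolding Suc hseq_Suc t_def by (rule Top_lower) (use u hseq_profile in auto)
  moreover have "u / t = 1 - max y 0" using t by (simp add: u_def)
  ultimately show ?thesis using u by (intro bexI[of _ u]) auto
qed

lemma hseq_pos:
  assumes "0 \<le> x" "x < 1"
  shows "0 < hseq n x"
proof (cases n)
  case 0
  then show ?thesis by (simp add: hseq_0)
next
  case (Suc m)
  then show ?thesis using Top_pos[OF hseq_profile hseq_near_0 assms] by (simp add: hseq_Suc)
qed

text \<open>\<open>no_up\<close> at one step is derived from \<open>no_down_up\<close> at the step
  before, so the induction carries both.\<close>

lemma hseq_no_up:
  assumes "profile f"
  shows "no_up (hseq n) ((Top ^^ n) f)"
proof -
  have "no_down_up (hseq n) ((Top ^^ n) f) \<and> no_up (hseq n) ((Top ^^ n) f)"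
  proof (induction n)
    case 0
    then show ?case using no_down_up_const_1[OF assms] no_up_const_1[OF assms] by (simp add: hseq_0)
  next
    case (Suc n)
    then show ?case
      using no_down_up_Top no_up_Top hseq_profile funpow_Top_profile[OF assms] by (simp add: hseq_Suc)
  qed
  then show ?thesis ..
qed

lemma funpow_Top_le_hseq:
  assumes "profile f" "0 \<le> x" "x \<le> 1"
  shows "(Top ^^ n) f x \<le> hseq n x"
proof (cases n)
  case 0
  then show ?thesis using profile_le_1[OF assms] by (simp add: hseq_0)
next
  case (Suc m)
  then show ?thesis
    using Top_mono_if_no_up[OF hseq_profile funpow_Top_profile hseq_no_up] assms by (simp add: hseq_Suc)
qed

section \<open>Monotonicity and uniform convergence of \<open>hseq\<close>\<close>

lemma intI_pinv_mono:
  assumes "profile f" "profile g" "\<And>x. 0 \<le> x \<Longrightarrow> x \<le> 1 \<Longrightarrow> g x \<le> f x"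
  shows "intI (pinv g) \<le> intI (pinv f)"
  unfolding intI_def
proof (rule integral_le)
  show "pinv g y \<le> pinv f y" if "y \<in> {0..1}" for y
    using pinv_mono[OF assms] that by auto
qed (use assms(1,2) in \<open>auto intro!: decreasing01_integrable pinv_decreasing01\<close>)

text \<open>The comparison is applied with \<open>Top\<close> of the constant 1 as starting
  function, whose iterates are \<open>hseq\<close> shifted by one.\<close>

lemma hseq_Suc_le:
  assumes "0 \<le> x" "x \<le> 1"
  shows "hseq (Suc n) x \<le> hseq n x"
  using funpow_Top_le_hseq[OF Top_profile[OF profile_const_1] assms, of n]
  by (simp add: hseq_def funpow_swap1)

text \<open>As \<open>t\<close> decreases, \<open>pinv (hseq (Suc n))\<close> at 1/2 is at least
  \<open>t (Suc n) / 2\<close>. In the rectangle over \<open>{1/4..1/2}\<close> the unknown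
  \<open>t (Suc n)\<close> cancels and leaves height 1/8 at 1/4, hence area 1/32.\<close>

lemma intI_pinv_hseq_ge: "1 / 32 \<le> intI (pinv (hseq (Suc (Suc n))))"
proof -
  define t where "t n = intI (pinv (hseq n))" for n
  have t: "0 < t n" for n unfolding t_def by (rule intI_pinv_pos[OF hseq_profile])
  have "t (Suc n) \<le> t n"
    unfolding t_def by (rule intI_pinv_mono[OF hseq_profile hseq_profile hseq_Suc_le])
  moreover have "t n * (1 - 1/2) \<le> pinv (hseq (Suc n)) (1/2)"
    unfolding t_def hseq_Suc by (rule pinv_Top_ge[OF hseq_profile]) auto
  ultimately have "t (Suc n) * (1/2) \<le> pinv (hseq (Suc n)) (1/2)" by simp
  then have "1/8 \<le> (1/2 - 1/4) * pinv (hseq (Suc n)) (1/2) / t (Suc n)"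
    using t[of "Suc n"] by (simp add: field_simps)
  also have "\<dots> \<le> hseq (Suc (Suc n)) (1/4)"
    unfolding t_def hseq_Suc[of "Suc n"] by (rule Top_ge_rectangle[OF hseq_profile]) auto
  finally have "1 / 32 \<le> hseq (Suc (Suc n)) (1/4) * (1/4)" by simp
  also have "\<dots> \<le> intI (pinv (hseq (Suc (Suc n))))" by (rule intI_pinv_lower[OF hseq_profile]) auto
  finally show ?thesis .
qed

text \<open>The slope bound at a step uses the integral of the step before, and the lower bound 1/32
  is available from index 2 on; hence the shift by 3.\<close>

lemma hseq_lipschitz: "32-lipschitz_on {0..1} (hseq (n + 3))"
proof -
  have *: "\<bar>hseq (n + 3) x - hseq (n + 3) y\<bar> \<le> 32 * \<bar>x - y\<bar>"
    if "0 \<le> x" "x \<le> y" "y \<le> 1" for x y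
  proof -
    define m where "m = Suc (Suc n)"
    have n: "n + 3 = Suc m" by (simp add: m_def)
    have m: "1 / 32 \<le> intI (pinv (hseq m))" unfolding m_def by (rule intI_pinv_hseq_ge)
    have "(y - x) / intI (pinv (hseq m)) \<le> (y - x) / (1 / 32)"
      using m that by (intro divide_left_mono) auto
    then show ?thesis
      using Top_diff_bounds[OF hseq_profile that, of m] that by (simp add: n hseq_Suc)
  qed
  show ?thesis
  proof (rule lipschitz_onI)
    fix x y :: real assume "x \<in> {0..1}" "y \<in> {0..1}"
    then show "dist (hseq (n + 3) x) (hseq (n + 3) y) \<le> 32 * dist x y"
      using *[of x y] *[of y x] by (cases "x \<le> y") (auto simp: dist_real_def abs_minus_commute)
  qed simp
qed

text \<open>The limit inherits the Lipschitz bound. Pointwise convergence on a finite net then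
  controls all of \<open>S\<close>, with one third of \<open>e\<close> each for the net and for the
  two moves to it.\<close>

lemma uniform_limit_if_equi_lipschitz:
  fixes u :: "nat \<Rightarrow> 'a :: metric_space \<Rightarrow> 'b :: metric_space"
  assumes S: "compact S" and lip: "eventually (\<lambda>n. L-lipschitz_on S (u n)) sequentially"
    and lim: "\<And>x. x \<in> S \<Longrightarrow> (\<lambda>n. u n x) \<longlonglongrightarrow> l x"
  shows "uniform_limit S u l sequentially"
proof (rule uniform_limitI)
  fix e :: real assume e: "0 < e"
  obtain n where "L-lipschitz_on S (u n)" using lip by (auto simp: eventually_sequentially)
  then have L: "0 \<le> L" by (rule lipschitz_on_nonneg)
  \<comment> \<open>The denominator has \<open>L + 1\<close> to cover \<open>L = 0\<close>.\<close>
  define r where "r = e / (3 * (L + 1))"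
  have r: "0 < r" "L * r \<le> e / 3"
  proof -
    have "L * r \<le> (L + 1) * r" using e L by (intro mult_right_mono) (auto simp: r_def)
    also have "\<dots> = e / 3" using L by (simp add: r_def divide_simps)
    finally show "L * r \<le> e / 3" .
  qed (use e L in \<open>simp add: r_def\<close>)
  have l: "dist (l x) (l y) \<le> L * dist x y" if "x \<in> S" "y \<in> S" for x y
  proof (rule tendsto_upperbound[OF tendsto_dist[OF lim lim]])
    show "eventually (\<lambda>n. dist (u n x) (u n y) \<le> L * dist x y) sequentially"
      using lip by eventually_elim (rule lipschitz_onD[OF _ that])
  qed (use that in auto)
  obtain k where k: "finite k" "k \<subseteq> S" "S \<subseteq> (\<Union>x\<in>k. ball x r)"
    using seq_compact_imp_totally_bounded[OF compact_imp_seq_compact[OF S], rule_format, OF r(1)]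
    by (elim exE conjE)
  have "eventually (\<lambda>n. \<forall>y\<in>k. dist (u n y) (l y) < e / 3) sequentially"
    using k e lim by (intro eventually_ball_finite ballI tendstoD) auto
  with lip show "eventually (\<lambda>n. \<forall>x\<in>S. dist (u n x) (l x) < e) sequentially"
  proof eventually_elim
    case (elim n)
    show ?case
    proof
      fix x assume x: "x \<in> S"
      then have "x \<in> (\<Union>y\<in>k. ball y r)" using k(3) by (rule subsetD[rotated])
      then obtain y where y: "y \<in> k" "dist y x < r" by auto
      have yS: "y \<in> S" using y(1) k(2) by (rule subsetD[rotated])
      have "L * dist x y \<le> L * r" using y L by (intro mult_left_mono) (auto simp: dist_commute)
      with r have L3: "L * dist x y \<le> e / 3" by linarith
      have "dist (u n x) (l x) \<le> dist (u n x) (u n y) + dist (u n y) (l y) + dist (l x) (l y)"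
        using dist_triangle[of "u n x" "l x" "u n y"] dist_triangle[of "u n y" "l x" "l y"]
        by (simp add: dist_commute)
      moreover have "dist (u n x) (u n y) \<le> L * dist x y" by (rule lipschitz_onD[OF elim(1) x yS])
      moreover have "dist (u n y) (l y) < e / 3" using elim y by auto
      ultimately show "dist (u n x) (l x) < e" using l[OF x yS] L3 by linarith
    qed
  qed
qed

lemma hseq_uniform_limit: "uniform_limit {0..1} hseq hlim sequentially"
proof (rule uniform_limit_if_equi_lipschitz)
  have "eventually (\<lambda>n. 32-lipschitz_on {0..1} (hseq (n + 3))) sequentially"
    by (simp add: hseq_lipschitz)
  then show "eventually (\<lambda>n. 32-lipschitz_on {0..1} (hseq n)) sequentially"
    by (rule eventually_sequentially_seg[THEN iffD1])
  fix x :: real assume x: "x \<in> {0..1}"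
  have "decseq (\<lambda>n. hseq n x)" using x hseq_Suc_le by (auto simp: decseq_Suc_iff)
  moreover have "0 \<le> hseq n x" for n
    using hseq_profile[of n] x by (auto simp: profile_def decreasing01_def)
  ultimately have "convergent (\<lambda>n. hseq n x)"
    using decseq_convergent[of "\<lambda>n. hseq n x" 0] by (metis convergentI)
  then show "(\<lambda>n. hseq n x) \<longlonglongrightarrow> hlim x"
    by (simp add: hlim_def convergent_LIMSEQ_iff)
qed simp

theorem theorem4p11:
  assumes "f \<in> classE"
  shows "uniform_limit {0..1} (\<lambda>n. (Top ^^ n) f) hlim sequentially"
proof -
  have f: "profile f" using assms by (rule classE_profile)
  define F where "F n = (Top ^^ n) f" for n
  have F: "profile (F n)" for n unfolding F_def by (rule funpow_Top_profile[OF f])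
  define c where "c n = intI (pinv (F n)) / intI (pinv (hseq n))" for n
  note Ppos = intI_pinv_pos[OF F] intI_pinv_pos[OF hseq_profile]
  have c0: "0 < c n" for n using Ppos by (simp add: c_def)
  have c1: "c n \<le> 1" for n
  proof -
    have "intI (pinv (F n)) \<le> intI (pinv (hseq n))"
      by (rule intI_pinv_mono[OF hseq_profile F]) (simp add: F_def funpow_Top_le_hseq f)
    then show ?thesis using Ppos by (simp add: c_def)
  qed
  have bound: "hseq (n + 2) x \<le> c (Suc n) / c n * F (n + 2) x" if "0 \<le> x" "x \<le> 1" for n x
  proof -
    have F_Suc: "F (Suc n) = Top (F n)" for n by (simp add: F_def)
    have "no_up (Top (hseq n)) (Top (F n))"
      using hseq_no_up[OF f, of "Suc n"] by (simp add: hseq_Suc F_def)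
    from Top_ratio_bound[OF hseq_profile F hseq_pos this that] show ?thesis
      by (simp add: c_def hseq_Suc F_Suc)
  qed
  \<comment> \<open>At 0 both functions in \<open>bound\<close> equal 1, so the factor itself is at
    least 1.\<close>
  have "1 \<le> c (Suc n) / c n" for n
    using bound[of 0 n] hseq_profile[of "n + 2"] F[of "n + 2"] by (simp add: profile_def)
  then have "incseq c" using c0 by (auto simp: incseq_Suc_iff field_simps)
  then obtain l where l: "c \<longlonglongrightarrow> l" "\<And>n. c n \<le> l"
    using incseq_convergent[of c 1] c1 by auto
  have "0 < l" using c0[of 0] l(2)[of 0] by linarith
  then have "(\<lambda>n. c (Suc n) / c n) \<longlonglongrightarrow> l / l"
    using l by (intro tendsto_divide LIMSEQ_Suc) auto
  then have ratio: "(\<lambda>n. c (Suc n) / c n) \<longlonglongrightarrow> 1" using \<open>0 < l\<close> by simp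
  have "uniform_limit {0..1} (\<lambda>n x. F n x - hseq n x) (\<lambda>_. 0) sequentially"
  proof (rule uniform_limitI)
    fix e :: real assume "0 < e"
    \<comment> \<open>The ratio bound speaks of indices from 2 on; the shift is removed at the
      end.\<close>
    have "eventually (\<lambda>n. \<forall>x\<in>{0..1}. dist (F (n + 2) x - hseq (n + 2) x) 0 < e) sequentially"
      using tendstoD[OF ratio \<open>0 < e\<close>]
    proof eventually_elim
      case (elim n)
      show ?case
      proof
        fix x :: real assume x: "x \<in> {0..1}"
        have FH: "F (n + 2) x \<le> hseq (n + 2) x" 
          unfolding F_def by (rule funpow_Top_le_hseq[OF f]) (use x in auto)
        have F01: "0 \<le> F (n + 2) x" "F (n + 2) x \<le> 1"
          using F[of "n + 2"] x profile_le_1[OF F[of "n + 2"], of x]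
          by (auto simp: profile_def decreasing01_def)
        \<comment> \<open>Since \<open>F\<close> is at most 1, the relative error from the ratio is
          an absolute error independent of \<open>x\<close>.\<close>
        have "hseq (n + 2) x - F (n + 2) x \<le> (c (Suc n) / c n - 1) * F (n + 2) x"
          using bound[of x n] x by (simp add: left_diff_distrib)
        also have "\<dots> \<le> \<bar>c (Suc n) / c n - 1\<bar> * 1"
          using F01 by (intro mult_mono) auto
        finally show "dist (F (n + 2) x - hseq (n + 2) x) 0 < e"
          using elim FH by (simp add: dist_real_def)
      qed
    qed
    then show "eventually (\<lambda>n. \<forall>x\<in>{0..1}. dist (F n x - hseq n x) 0 < e) sequentially"
      by (rule eventually_sequentially_seg[THEN iffD1])
  qed
  from uniform_limit_add[OF this hseq_uniform_limit] show ?thesis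
    by (simp add: F_def)
qed

end
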